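(* Let $E\in\mathcal P^e$ be a well-formed labeled $\pi$-calculus term. Then: (1) (Unicity) no label $\langle s,n\rangle$ occurs more than once in $E$ (as the subscript of a prefix or of a replication); (2) (Disappearance) if $E\xrightarrow{\mu}E'$ then there is $\langle s,n\rangle\in lab(E)$ with $\langle s,n\rangle\notin lab(E')$; (3) (Persistence) for every $k\ge 1$ and every sequence of transitions $E=E_0\xrightarrow{\mu_0}E_1\xrightarrow{\mu_1}E_2\cdots\xrightarrow{\mu_{k-1}}E_k$, if $\langle s,n\rangle\in lab(E_0)\cap lab(E_k)$ then $\langle s,n\rangle\in lab(E_i)$ for every $i\in\{1,\dots,k-1\}$.
   Context: Unlabeled processes. Let $\mathcal N$ be an infinite set of names. The set $\mathcal P$ of processes is generated by $P::=0\mid x(y).P\mid \bar xy.P\mid P\,|\,P\mid(\nu x)P\mid\, !P$ ($x,y\in\mathcal N$); $x(y).P$ and $(\nu x)P$ bind $y$, resp. $x$; free names $fn$, bound names $bn$ and $n(\cdot)=fn(\cdot)\cup bn(\cdot)$ are as usual, and terms are considered up to alpha-conversion. Actions $\mu$ are $xy$ (input), $\bar xy$ (output), $\bar x(y)$ (bound output) and $\tau$, with $bn(\bar x(y))=\{y\}$, $bn(\mu)=\emptyset$ otherwise, $fn(xy)=fn(\bar xy)=\{x,y\}$, $fn(\bar x(y))=\{x\}$, $fn(\tau)=\emptyset$. The (early) transition relation $\xrightarrow{\mu}$ is the least relation closed under: Input $x(y).P\xrightarrow{xz}P\{z/y\}$; Output $\bar xy.P\xrightarrow{\bar xy}P$;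 Open: $P\xrightarrow{\bar xy}P'$, $x\neq y$ imply $(\nu y)P\xrightarrow{\bar x(y)}P'$; Res: $P\xrightarrow{\mu}P'$, $y\notin n(\mu)$ imply $(\nu y)P\xrightarrow{\mu}(\nu y)P'$; Par: $P\xrightarrow{\mu}P'$, $bn(\mu)\cap fn(Q)=\emptyset$ imply $P|Q\xrightarrow{\mu}P'|Q$; Com: $P\xrightarrow{xy}P'$, $Q\xrightarrow{\bar xy}Q'$ imply $P|Q\xrightarrow{\tau}P'|Q'$; Close: $P\xrightarrow{xy}P'$, $Q\xrightarrow{\bar x(y)}Q'$, $y\notin fn(P)$ imply $P|Q\xrightarrow{\tau}(\nu y)(P'|Q')$; the symmetric versions of Par, Com, Close; Rep: $P\xrightarrow{\mu}P'$ implies $!P\xrightarrow{\mu}P'|!P$. Labeled terms. Labels are pairs $\langle s,n\rangle\in\{0,1\}^*\times\mathbb N$. For strings, $s_0\sqsubseteq s_1$ means $s_0$ is a prefix of $s_1$. For sets of labels, $L_0\,\Re\,L_1$ iff for all $\langle s_0,n_0\rangle\in L_0$ and $\langle s_1,n_1\rangle\in L_1$ we have $s_0\not\sqsubseteq s_1$ and $s_1\not\sqsubseteq s_0$. Ground labeled terms $\mathcal P^e_{gr}$: $E::=0\mid \mu_{\langle s,n\rangle}.E\mid(\nu x)E\mid E\,|\,E\mid\, !_{\langle s,n\rangle}P$, where $\mu$ is a prefix $x(y)$ or $\bar xy$ and $P\in\mathcal P$ is unlabeled. The labeling function $L_{\langle s,n\rangle}:\mathcal P\to\mathcal P^e_{gr}$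 is: $L_{\langle s,n\rangle}(0)=0$; $L_{\langle s,n\rangle}(\mu.P)=\mu_{\langle s,n\rangle}.L_{\langle s,n+1\rangle}(P)$; $L_{\langle s,n\rangle}(P_0|P_1)=L_{\langle s0,n\rangle}(P_0)\,|\,L_{\langle s1,n\rangle}(P_1)$; $L_{\langle s,n\rangle}((\nu x)P)=(\nu x)L_{\langle s,n\rangle}(P)$; $L_{\langle s,n\rangle}(!P)=\,!_{\langle s,n\rangle}P$. Top-level labels and all labels: $top(0)=lab(0)=\emptyset$; $top(\mu_v.E)=\{v\}$, $lab(\mu_v.E)=\{v\}\cup lab(E)$; $top((\nu x)E)=top(E)$, $lab((\nu x)E)=lab(E)$; $top(E_0|E_1)=top(E_0)\cup top(E_1)$, $lab(E_0|E_1)=lab(E_0)\cup lab(E_1)$; $top(!_vP)=lab(!_vP)=\{v\}$. The well-formedness predicate $wf$ is the least predicate such that: $wf(0)$; $wf(L_{\langle s,n\rangle}(\mu.P))$ for every $\mu.P\in\mathcal P$ and every label; $wf(E_0|E_1)$ whenever $wf(E_0)$, $wf(E_1)$ and $top(E_0)\,\Re\,top(E_1)$; $wf((\nu x)E)$ whenever $wf(E)$; $wf(!_{\langle s,n\rangle}P)$ for every $P\in\mathcal P$ and every label. $\mathcal P^e=\{E\in\mathcal P^e_{gr}: wf(E)\}$. Transitions of labeled terms use the same rules as for unlabeled terms with labels ignored (e.g. $x(y)_v.E\xrightarrow{xz}E\{z/y\}$, substitution not affecting labels; $\bar xy_v.E\xrightarrow{\bar xy}E$; Open, Res, Par, Com,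 Close and symmetric versions unchanged), except that replication is given by: if $P\xrightarrow{\mu}P'$ in the unlabeled semantics then $!_{\langle s,n\rangle}P\xrightarrow{\mu}L_{\langle s0,n+1\rangle}(P')\,|\,!_{\langle s1,n+1\rangle}P$. *)

theory Defs
  imports Main "HOL-Library.Infinite_Typeclass" "HOL-Library.Sublist" "HOL-Library.Multiset"
begin

text \<open>
  The infinite set of names is the universe of a type of class \<open>infinite\<close>. Processes and labeled
  terms are quotients by alpha-conversion of datatypes of raw terms with named binders.
\<close>

section \<open>Unlabeled processes\<close>

subsection \<open>Raw terms\<close>

text \<open>\<open>RIn x y P\<close> is \<open>x(y).P\<close>, binding \<open>y\<close> in \<open>P\<close>; \<open>ROut x y P\<close> is the output of \<open>y\<close> on \<open>x\<close>;
  \<open>RRes x P\<close> is \<open>(\<nu>x)P\<close>.\<close>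

datatype 'a rproc =
    RNil
  | RIn 'a 'a "'a rproc"
  | ROut 'a 'a "'a rproc"
  | RPar "'a rproc" "'a rproc"
  | RRes 'a "'a rproc"
  | RRep "'a rproc"

primrec rfn :: "'a rproc \<Rightarrow> 'a set" where
  "rfn RNil = {}"
| "rfn (RIn x y P) = {x} \<union> (rfn P - {y})"
| "rfn (ROut x y P) = {x, y} \<union> rfn P"
| "rfn (RPar P Q) = rfn P \<union> rfn Q"
| "rfn (RRes x P) = rfn P - {x}"
| "rfn (RRep P) = rfn P"

definition fresh_name :: "'a set \<Rightarrow> 'a" where
  "fresh_name A = (SOME y. y \<notin> A)"

text \<open>
  Simultaneous capture-avoiding substitution of \<open>\<sigma> a\<close> for every free occurrence of \<open>a\<close>. Every
  binder is renamed to a name \<open>y'\<close> outside the image of the other free names of its scope.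
\<close>

primrec rsubst :: "('a \<Rightarrow> 'a) \<Rightarrow> 'a rproc \<Rightarrow> 'a rproc" where
  "rsubst \<sigma> RNil = RNil"
| "rsubst \<sigma> (RIn x y P) =
     (let y' = fresh_name (\<sigma> ` (rfn P - {y})) in RIn (\<sigma> x) y' (rsubst (\<sigma>(y := y')) P))"
| "rsubst \<sigma> (ROut x y P) = ROut (\<sigma> x) (\<sigma> y) (rsubst \<sigma> P)"
| "rsubst \<sigma> (RPar P Q) = RPar (rsubst \<sigma> P) (rsubst \<sigma> Q)"
| "rsubst \<sigma> (RRes y P) =
     (let y' = fresh_name (\<sigma> ` (rfn P - {y})) in RRes y' (rsubst (\<sigma>(y := y')) P))"
| "rsubst \<sigma> (RRep P) = RRep (rsubst \<sigma> P)"

text \<open>Alpha-conversion: the least congruence allowing the change of a bound name.\<close>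

inductive ralpha :: "'a rproc \<Rightarrow> 'a rproc \<Rightarrow> bool" where
  refl: "ralpha P P"
| sym: "ralpha P Q \<Longrightarrow> ralpha Q P"
| trans: "ralpha P Q \<Longrightarrow> ralpha Q R \<Longrightarrow> ralpha P R"
| RIn: "ralpha P Q \<Longrightarrow> ralpha (RIn x y P) (RIn x y Q)"
| ROut: "ralpha P Q \<Longrightarrow> ralpha (ROut x y P) (ROut x y Q)"
| RPar: "ralpha P P' \<Longrightarrow> ralpha Q Q' \<Longrightarrow> ralpha (RPar P Q) (RPar P' Q')"
| RRes: "ralpha P Q \<Longrightarrow> ralpha (RRes x P) (RRes x Q)"
| RRep: "ralpha P Q \<Longrightarrow> ralpha (RRep P) (RRep Q)"
| RIn_rename: "z \<notin> rfn P \<Longrightarrow> ralpha (RIn x y P) (RIn x z (rsubst (id(y := z)) P))"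
| RRes_rename: "z \<notin> rfn P \<Longrightarrow> ralpha (RRes y P) (RRes z (rsubst (id(y := z)) P))"

lemma fresh_name:
  fixes A :: "'a::infinite set"
  assumes "finite A"
  shows "fresh_name A \<notin> A"
  unfolding fresh_name_def using ex_new_if_finite[OF infinite_UNIV assms] by (rule someI_ex)

lemma id_image: "id ` A = A"
  by simp

lemma image_scope:
  assumes "y' \<notin> \<sigma> ` (A - {y})"
  shows "(\<sigma>(y := y')) ` A - {y'} = \<sigma> ` (A - {y})"
  using assms by (auto simp: image_iff split: if_splits)

lemma finite_rfn: "finite (rfn P)"
  by (induction P) auto

lemma fresh_rfn: "fresh_name (\<sigma> ` (rfn P - A)) \<notin> \<sigma> ` (rfn P - A)"
  for \<sigma> :: "'a \<Rightarrow> 'a::infinite"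
  by (simp add: fresh_name finite_rfn)

lemma rfn_rsubst:
  fixes P :: "'a::infinite rproc"
  shows "rfn (rsubst \<sigma> P) = \<sigma> ` rfn P"
proof (induction P arbitrary: \<sigma>)
  case (RIn x y P)
  show ?case
    unfolding rsubst.simps rfn.simps Let_def RIn.IH image_scope[OF fresh_rfn] by simp
next
  case (RRes y P)
  show ?case
    unfolding rsubst.simps rfn.simps Let_def RRes.IH image_scope[OF fresh_rfn] ..
qed (simp_all add: image_Un)

lemma rsubst_cong: "(\<And>a. a \<in> rfn P \<Longrightarrow> \<sigma> a = \<tau> a) \<Longrightarrow> rsubst \<sigma> P = rsubst \<tau> P"
proof (induction P arbitrary: \<sigma> \<tau>)
  case (RIn x y P)
  have "\<sigma> ` (rfn P - {y}) = \<tau> ` (rfn P - {y})"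
    using RIn.prems by (intro image_cong) auto
  moreover have "rsubst (\<sigma>(y := z)) P = rsubst (\<tau>(y := z)) P" for z
    using RIn.prems by (intro RIn.IH) auto
  ultimately show ?case using RIn.prems by (simp add: Let_def)
next
  case (RRes y P)
  have "\<sigma> ` (rfn P - {y}) = \<tau> ` (rfn P - {y})"
    using RRes.prems by (intro image_cong) auto
  moreover have "rsubst (\<sigma>(y := z)) P = rsubst (\<tau>(y := z)) P" for z
    using RRes.prems by (intro RRes.IH) auto
  ultimately show ?case by (simp add: Let_def)
next
  case (RPar P Q)
  have "rsubst \<sigma> P = rsubst \<tau> P" "rsubst \<sigma> Q = rsubst \<tau> Q"
    using RPar.prems by (auto intro!: RPar.IH)
  then show ?case by simp
next
  case (ROut x y P)
  have "rsubst \<sigma> P = rsubst \<tau> P"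
    using ROut.prems by (intro ROut.IH) auto
  then show ?case using ROut.prems by simp
next
  case (RRep P)
  have "rsubst \<sigma> P = rsubst \<tau> P"
    using RRep.prems by (intro RRep.IH) auto
  then show ?case by simp
qed simp

lemma rsubst_upd:
  fixes \<sigma> :: "'a \<Rightarrow> 'a::infinite"
  assumes "y' \<notin> \<tau> ` (rfn P - {y})"
  shows "rsubst (\<sigma>(y' := z) \<circ> \<tau>(y := y')) P = rsubst ((\<sigma> \<circ> \<tau>)(y := z)) P"
  using assms by (intro rsubst_cong) auto

lemma rsubst_rsubst:
  fixes P :: "'a::infinite rproc"
  shows "rsubst \<sigma> (rsubst \<tau> P) = rsubst (\<sigma> \<circ> \<tau>) P"
proof (induction P arbitrary: \<sigma> \<tau>)
  case (RIn x y P)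
  show ?case
    by (simp only: rsubst.simps Let_def RIn.IH rfn_rsubst image_scope[OF fresh_rfn]
        rsubst_upd[OF fresh_rfn] image_comp o_apply[of \<sigma> \<tau> x])
next
  case (RRes y P)
  show ?case
    by (simp only: rsubst.simps Let_def RRes.IH rfn_rsubst image_scope[OF fresh_rfn]
        rsubst_upd[OF fresh_rfn] image_comp)
qed simp_all

lemma rsubst_rename:
  fixes P :: "'a::infinite rproc"
  assumes z: "z \<notin> rfn P"
  shows "rfn (rsubst (id(y := z)) P) - {z} = rfn P - {y}"
    and "rsubst (\<sigma>(z := w)) (rsubst (id(y := z)) P) = rsubst (\<sigma>(y := w)) P"
proof -
  have "z \<notin> id ` (rfn P - {y})" using z by simp
  from image_scope[OF this] show "rfn (rsubst (id(y := z)) P) - {z} = rfn P - {y}"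
    by (simp add: rfn_rsubst)
  show "rsubst (\<sigma>(z := w)) (rsubst (id(y := z)) P) = rsubst (\<sigma>(y := w)) P"
    unfolding rsubst_rsubst using z by (intro rsubst_cong) auto
qed

lemma ralpha_rfn: "ralpha P Q \<Longrightarrow> rfn P = rfn Q" for P :: "'a::infinite rproc"
  by (induction rule: ralpha.induct) (simp_all add: rsubst_rename)

lemma ralpha_rsubst: "ralpha P Q \<Longrightarrow> rsubst \<sigma> P = rsubst \<sigma> Q" for P :: "'a::infinite rproc"
  by (induction arbitrary: \<sigma> rule: ralpha.induct)
    (simp_all add: Let_def ralpha_rfn rsubst_rename)

lemma ralpha_binder:
  fixes P :: "'a::infinite rproc"
    and y z :: 'a
  defines "z \<equiv> fresh_name (rfn P - {y})"
  assumes "ralpha (rsubst id P) P"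
  shows "ralpha (RIn x z (rsubst (id(y := z)) P)) (RIn x y P)"
    and "ralpha (RRes z (rsubst (id(y := z)) P)) (RRes y P)"
proof -
  have "z = y \<or> z \<notin> rfn P"
    using fresh_rfn[of id P "{y}"] by (auto simp: z_def)
  then show "ralpha (RIn x z (rsubst (id(y := z)) P)) (RIn x y P)"
    "ralpha (RRes z (rsubst (id(y := z)) P)) (RRes y P)"
    using assms(2)
    by (auto simp: fun_upd_idem intro: ralpha.RIn ralpha.RRes
        ralpha.sym[OF ralpha.RIn_rename] ralpha.sym[OF ralpha.RRes_rename])
qed

lemma ralpha_rsubst_id: "ralpha (rsubst id P) P" for P :: "'a::infinite rproc"
proof (induction P)
  case (RIn x y P)
  from ralpha_binder(1)[OF this] show ?case
    by (simp only: rsubst.simps Let_def id_image id_apply[of x])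
next
  case (RRes y P)
  from ralpha_binder(2)[OF this] show ?case
    by (simp only: rsubst.simps Let_def id_image)
qed (auto intro: ralpha.intros)

lemma ralpha_iff: "ralpha P Q \<longleftrightarrow> rsubst id P = rsubst id Q" for P Q :: "'a::infinite rproc"
  by (metis ralpha_rsubst ralpha_rsubst_id ralpha.sym ralpha.trans)

subsection \<open>Processes\<close>

quotient_type (overloaded) 'a proc = "'a::infinite rproc" / ralpha
  by (intro equivpI reflpI sympI transpI) (fact ralpha.refl, erule ralpha.sym, erule (1) ralpha.trans)

lift_definition PNil :: "'a::infinite proc" is RNil .
lift_definition PIn :: "'a \<Rightarrow> 'a \<Rightarrow> 'a::infinite proc \<Rightarrow> 'a proc" is RIn by (rule ralpha.RIn)
lift_definition POut :: "'a \<Rightarrow> 'a \<Rightarrow> 'a::infinite proc \<Rightarrow> 'a proc" is ROut by (rule ralpha.ROut)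
lift_definition PPar :: "'a::infinite proc \<Rightarrow> 'a proc \<Rightarrow> 'a proc" is RPar by (rule ralpha.RPar)
lift_definition PRes :: "'a \<Rightarrow> 'a::infinite proc \<Rightarrow> 'a proc" is RRes by (rule ralpha.RRes)
lift_definition PRep :: "'a::infinite proc \<Rightarrow> 'a proc" is RRep by (rule ralpha.RRep)

lift_definition fn :: "'a::infinite proc \<Rightarrow> 'a set" is rfn by (rule ralpha_rfn)

lift_definition subst :: "('a \<Rightarrow> 'a) \<Rightarrow> 'a::infinite proc \<Rightarrow> 'a proc" is rsubst
  by (simp add: ralpha_rsubst ralpha.refl)

text \<open>\<open>subst1 P z y\<close> is \<open>P{z/y}\<close>.\<close>

definition subst1 :: "'a::infinite proc \<Rightarrow> 'a \<Rightarrow> 'a \<Rightarrow> 'a proc" where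
  "subst1 P z y = subst (id(y := z)) P"

lemma fn_simps [simp]:
  "fn PNil = {}"
  "fn (PIn x y P) = {x} \<union> (fn P - {y})"
  "fn (POut x y P) = {x, y} \<union> fn P"
  "fn (PPar P Q) = fn P \<union> fn Q"
  "fn (PRes x P) = fn P - {x}"
  "fn (PRep P) = fn P"
  by (transfer; simp)+

lemma proc_alpha:
  "z \<notin> fn P \<Longrightarrow> PIn x y P = PIn x z (subst1 P z y)"
  "z \<notin> fn P \<Longrightarrow> PRes y P = PRes z (subst1 P z y)"
  unfolding subst1_def
  by (transfer, rule ralpha.RIn_rename, assumption) (transfer, rule ralpha.RRes_rename, assumption)

lemma rsubst_RIn:
  fixes P :: "'a::infinite rproc"
  assumes "y \<notin> \<sigma> ` (rfn P - {y})"
  shows "ralpha (rsubst \<sigma> (RIn x y P)) (RIn (\<sigma> x) y (rsubst (\<sigma>(y := y)) P))"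
    and "ralpha (rsubst \<sigma> (RRes y P)) (RRes y (rsubst (\<sigma>(y := y)) P))"
  unfolding ralpha_iff rsubst_rsubst
  by (simp_all only: rsubst.simps Let_def rsubst_rsubst rfn_rsubst image_scope[OF assms]
      rsubst_upd[OF assms] id_o id_image id_apply[of "\<sigma> x"])

text \<open>The usual defining equations of substitution; by alpha-conversion the bound name can
  always be chosen such that the premise of \<open>subst_binder\<close> holds.\<close>

lemma subst_simps [simp]:
  "subst \<sigma> PNil = PNil"
  "subst \<sigma> (POut x y P) = POut (\<sigma> x) (\<sigma> y) (subst \<sigma> P)"
  "subst \<sigma> (PPar P Q) = PPar (subst \<sigma> P) (subst \<sigma> Q)"
  "subst \<sigma> (PRep P) = PRep (subst \<sigma> P)"
  by (transfer; simp add: ralpha.refl)+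

lemma subst_binder:
  "y \<notin> \<sigma> ` (fn P - {y}) \<Longrightarrow> subst \<sigma> (PIn x y P) = PIn (\<sigma> x) y (subst (\<sigma>(y := y)) P)"
  "y \<notin> \<sigma> ` (fn P - {y}) \<Longrightarrow> subst \<sigma> (PRes y P) = PRes y (subst (\<sigma>(y := y)) P)"
proof (transfer, rule rsubst_RIn(1), assumption)
qed (transfer, rule rsubst_RIn(2), assumption)

lemma finite_fn: "finite (fn P)"
  by transfer (rule finite_rfn)

lemma fn_subst: "fn (subst \<sigma> P) = \<sigma> ` fn P"
  by transfer (rule rfn_rsubst)

lemma subst_cong: "(\<And>a. a \<in> fn P \<Longrightarrow> \<sigma> a = \<tau> a) \<Longrightarrow> subst \<sigma> P = subst \<tau> P"
  by transfer (metis rsubst_cong ralpha.refl)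

lemma subst_subst: "subst \<sigma> (subst \<tau> P) = subst (\<sigma> \<circ> \<tau>) P"
  by transfer (simp add: rsubst_rsubst ralpha.refl)

lemma subst_id: "subst id P = P"
  by transfer (rule ralpha_rsubst_id)

subsection \<open>Transitions\<close>

text \<open>\<open>InAct x y\<close> is the input of \<open>y\<close> on \<open>x\<close>; \<open>OutAct x y\<close> and \<open>BOutAct x y\<close> are the free and
  the bound output of \<open>y\<close> on \<open>x\<close>.\<close>

datatype 'a action =
    InAct 'a 'a
  | OutAct 'a 'a
  | BOutAct 'a 'a
  | Tau

primrec act_bn :: "'a action \<Rightarrow> 'a set" where
  "act_bn (InAct x y) = {}"
| "act_bn (OutAct x y) = {}"
| "act_bn (BOutAct x y) = {y}"
| "act_bn Tau = {}"

primrec act_fn :: "'a action \<Rightarrow> 'a set" where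
  "act_fn (InAct x y) = {x, y}"
| "act_fn (OutAct x y) = {x, y}"
| "act_fn (BOutAct x y) = {x}"
| "act_fn Tau = {}"

definition act_n :: "'a action \<Rightarrow> 'a set" where
  "act_n \<mu> = act_fn \<mu> \<union> act_bn \<mu>"

inductive ptrans :: "'a::infinite proc \<Rightarrow> 'a action \<Rightarrow> 'a proc \<Rightarrow> bool" where
  Input: "ptrans (PIn x y P) (InAct x z) (subst1 P z y)"
| Output: "ptrans (POut x y P) (OutAct x y) P"
| Open: "ptrans P (OutAct x y) P' \<Longrightarrow> x \<noteq> y \<Longrightarrow> ptrans (PRes y P) (BOutAct x y) P'"
| Res: "ptrans P \<mu> P' \<Longrightarrow> y \<notin> act_n \<mu> \<Longrightarrow> ptrans (PRes y P) \<mu> (PRes y P')"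
| ParL: "ptrans P \<mu> P' \<Longrightarrow> act_bn \<mu> \<inter> fn Q = {} \<Longrightarrow> ptrans (PPar P Q) \<mu> (PPar P' Q)"
| ParR: "ptrans Q \<mu> Q' \<Longrightarrow> act_bn \<mu> \<inter> fn P = {} \<Longrightarrow> ptrans (PPar P Q) \<mu> (PPar P Q')"
| ComL: "ptrans P (InAct x y) P' \<Longrightarrow> ptrans Q (OutAct x y) Q' \<Longrightarrow>
    ptrans (PPar P Q) Tau (PPar P' Q')"
| ComR: "ptrans P (OutAct x y) P' \<Longrightarrow> ptrans Q (InAct x y) Q' \<Longrightarrow>
    ptrans (PPar P Q) Tau (PPar P' Q')"
| CloseL: "ptrans P (InAct x y) P' \<Longrightarrow> ptrans Q (BOutAct x y) Q' \<Longrightarrow> y \<notin> fn P \<Longrightarrow>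
    ptrans (PPar P Q) Tau (PRes y (PPar P' Q'))"
| CloseR: "ptrans P (BOutAct x y) P' \<Longrightarrow> ptrans Q (InAct x y) Q' \<Longrightarrow> y \<notin> fn Q \<Longrightarrow>
    ptrans (PPar P Q) Tau (PRes y (PPar P' Q'))"
| Rep: "ptrans P \<mu> P' \<Longrightarrow> ptrans (PRep P) \<mu> (PPar P' (PRep P))"

section \<open>Labeled terms\<close>

subsection \<open>Labels\<close>

datatype bit = B0 | B1

type_synonym label = "bit list \<times> nat"

definition incomparable :: "label set \<Rightarrow> label set \<Rightarrow> bool" (infix "\<Re>" 50) where
  "L0 \<Re> L1 \<longleftrightarrow>
     (\<forall>(s0, n0) \<in> L0. \<forall>(s1, n1) \<in> L1. \<not> prefix s0 s1 \<and> \<not> prefix s1 s0)"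

subsection \<open>Raw terms\<close>

text \<open>The argument of a labeled replication is an unlabeled process, already taken up to
  alpha-conversion.\<close>

datatype ('a::infinite) rterm =
    LNil
  | LIn label 'a 'a "'a rterm"
  | LOut label 'a 'a "'a rterm"
  | LPar "'a rterm" "'a rterm"
  | LRes 'a "'a rterm"
  | LRep label "'a proc"

primrec lfn :: "'a::infinite rterm \<Rightarrow> 'a set" where
  "lfn LNil = {}"
| "lfn (LIn v x y E) = {x} \<union> (lfn E - {y})"
| "lfn (LOut v x y E) = {x, y} \<union> lfn E"
| "lfn (LPar E F) = lfn E \<union> lfn F"
| "lfn (LRes x E) = lfn E - {x}"
| "lfn (LRep v P) = fn P"

primrec lsubst :: "('a \<Rightarrow> 'a) \<Rightarrow> 'a::infinite rterm \<Rightarrow> 'a rterm" where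
  "lsubst \<sigma> LNil = LNil"
| "lsubst \<sigma> (LIn v x y E) =
     (let y' = fresh_name (\<sigma> ` (lfn E - {y})) in LIn v (\<sigma> x) y' (lsubst (\<sigma>(y := y')) E))"
| "lsubst \<sigma> (LOut v x y E) = LOut v (\<sigma> x) (\<sigma> y) (lsubst \<sigma> E)"
| "lsubst \<sigma> (LPar E F) = LPar (lsubst \<sigma> E) (lsubst \<sigma> F)"
| "lsubst \<sigma> (LRes y E) =
     (let y' = fresh_name (\<sigma> ` (lfn E - {y})) in LRes y' (lsubst (\<sigma>(y := y')) E))"
| "lsubst \<sigma> (LRep v P) = LRep v (subst \<sigma> P)"

inductive lalpha :: "'a::infinite rterm \<Rightarrow> 'a rterm \<Rightarrow> bool" where
  refl: "lalpha E E"
| sym: "lalpha E F \<Longrightarrow> lalpha F E"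
| trans: "lalpha E F \<Longrightarrow> lalpha F G \<Longrightarrow> lalpha E G"
| LIn: "lalpha E F \<Longrightarrow> lalpha (LIn v x y E) (LIn v x y F)"
| LOut: "lalpha E F \<Longrightarrow> lalpha (LOut v x y E) (LOut v x y F)"
| LPar: "lalpha E E' \<Longrightarrow> lalpha F F' \<Longrightarrow> lalpha (LPar E F) (LPar E' F')"
| LRes: "lalpha E F \<Longrightarrow> lalpha (LRes x E) (LRes x F)"
| LIn_rename: "z \<notin> lfn E \<Longrightarrow> lalpha (LIn v x y E) (LIn v x z (lsubst (id(y := z)) E))"
| LRes_rename: "z \<notin> lfn E \<Longrightarrow> lalpha (LRes y E) (LRes z (lsubst (id(y := z)) E))"

lemma finite_lfn: "finite (lfn P)"
  by (induction P) (auto simp: finite_fn)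

lemma fresh_lfn: "fresh_name (\<sigma> ` (lfn P - A)) \<notin> \<sigma> ` (lfn P - A)"
  for \<sigma> :: "'a \<Rightarrow> 'a::infinite"
  by (simp add: fresh_name finite_lfn)

lemma lfn_lsubst:
  fixes P :: "'a::infinite rterm"
  shows "lfn (lsubst \<sigma> P) = \<sigma> ` lfn P"
proof (induction P arbitrary: \<sigma>)
  case (LIn v x y P)
  show ?case
    unfolding lsubst.simps lfn.simps Let_def LIn.IH image_scope[OF fresh_lfn] by simp
next
  case (LRes y P)
  show ?case
    unfolding lsubst.simps lfn.simps Let_def LRes.IH image_scope[OF fresh_lfn] ..
qed (simp_all add: image_Un fn_subst)

lemma lsubst_cong: "(\<And>a. a \<in> lfn P \<Longrightarrow> \<sigma> a = \<tau> a) \<Longrightarrow> lsubst \<sigma> P = lsubst \<tau> P"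
proof (induction P arbitrary: \<sigma> \<tau>)
  case (LIn v x y P)
  have "\<sigma> ` (lfn P - {y}) = \<tau> ` (lfn P - {y})"
    using LIn.prems by (intro image_cong) auto
  moreover have "lsubst (\<sigma>(y := z)) P = lsubst (\<tau>(y := z)) P" for z
    using LIn.prems by (intro LIn.IH) auto
  ultimately show ?case using LIn.prems by (simp add: Let_def)
next
  case (LRes y P)
  have "\<sigma> ` (lfn P - {y}) = \<tau> ` (lfn P - {y})"
    using LRes.prems by (intro image_cong) auto
  moreover have "lsubst (\<sigma>(y := z)) P = lsubst (\<tau>(y := z)) P" for z
    using LRes.prems by (intro LRes.IH) auto
  ultimately show ?case by (simp add: Let_def)
next
  case (LPar P Q)
  have "lsubst \<sigma> P = lsubst \<tau> P" "lsubst \<sigma> Q = lsubst \<tau> Q"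
    using LPar.prems by (auto intro!: LPar.IH)
  then show ?case by simp
next
  case (LOut v x y P)
  have "lsubst \<sigma> P = lsubst \<tau> P"
    using LOut.prems by (intro LOut.IH) auto
  then show ?case using LOut.prems by simp
next
  case (LRep v P)
  then show ?case by (auto intro!: subst_cong)
qed simp

lemma lsubst_upd:
  fixes \<sigma> :: "'a \<Rightarrow> 'a::infinite"
  assumes "y' \<notin> \<tau> ` (lfn P - {y})"
  shows "lsubst (\<sigma>(y' := z) \<circ> \<tau>(y := y')) P = lsubst ((\<sigma> \<circ> \<tau>)(y := z)) P"
  using assms by (intro lsubst_cong) auto

lemma lsubst_lsubst:
  fixes P :: "'a::infinite rterm"
  shows "lsubst \<sigma> (lsubst \<tau> P) = lsubst (\<sigma> \<circ> \<tau>) P"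
proof (induction P arbitrary: \<sigma> \<tau>)
  case (LIn v x y P)
  show ?case
    by (simp only: lsubst.simps Let_def LIn.IH lfn_lsubst image_scope[OF fresh_lfn]
        lsubst_upd[OF fresh_lfn] image_comp o_apply[of \<sigma> \<tau> x])
next
  case (LRes y P)
  show ?case
    by (simp only: lsubst.simps Let_def LRes.IH lfn_lsubst image_scope[OF fresh_lfn]
        lsubst_upd[OF fresh_lfn] image_comp)
qed (simp_all add: subst_subst)

lemma lsubst_rename:
  fixes P :: "'a::infinite rterm"
  assumes z: "z \<notin> lfn P"
  shows "lfn (lsubst (id(y := z)) P) - {z} = lfn P - {y}"
    and "lsubst (\<sigma>(z := w)) (lsubst (id(y := z)) P) = lsubst (\<sigma>(y := w)) P"
proof -
  have "z \<notin> id ` (lfn P - {y})" using z by simp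
  from image_scope[OF this] show "lfn (lsubst (id(y := z)) P) - {z} = lfn P - {y}"
    by (simp add: lfn_lsubst)
  show "lsubst (\<sigma>(z := w)) (lsubst (id(y := z)) P) = lsubst (\<sigma>(y := w)) P"
    unfolding lsubst_lsubst using z by (intro lsubst_cong) auto
qed

lemma lalpha_lfn: "lalpha P Q \<Longrightarrow> lfn P = lfn Q" for P :: "'a::infinite rterm"
  by (induction rule: lalpha.induct) (simp_all add: lsubst_rename)

lemma lalpha_lsubst: "lalpha P Q \<Longrightarrow> lsubst \<sigma> P = lsubst \<sigma> Q" for P :: "'a::infinite rterm"
  by (induction arbitrary: \<sigma> rule: lalpha.induct)
    (simp_all add: Let_def lalpha_lfn lsubst_rename)

lemma lalpha_binder:
  fixes P :: "'a::infinite rterm"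
    and y z :: 'a
  defines "z \<equiv> fresh_name (lfn P - {y})"
  assumes "lalpha (lsubst id P) P"
  shows "lalpha (LIn v x z (lsubst (id(y := z)) P)) (LIn v x y P)"
    and "lalpha (LRes z (lsubst (id(y := z)) P)) (LRes y P)"
proof -
  have "z = y \<or> z \<notin> lfn P"
    using fresh_lfn[of id P "{y}"] by (auto simp: z_def)
  then show "lalpha (LIn v x z (lsubst (id(y := z)) P)) (LIn v x y P)"
    "lalpha (LRes z (lsubst (id(y := z)) P)) (LRes y P)"
    using assms(2)
    by (auto simp: fun_upd_idem intro: lalpha.LIn lalpha.LRes
        lalpha.sym[OF lalpha.LIn_rename] lalpha.sym[OF lalpha.LRes_rename])
qed

lemma lalpha_lsubst_id: "lalpha (lsubst id P) P" for P :: "'a::infinite rterm"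
proof (induction P)
  case (LIn v x y P)
  from lalpha_binder(1)[OF this] show ?case
    by (simp only: lsubst.simps Let_def id_image id_apply[of x])
next
  case (LRes y P)
  from lalpha_binder(2)[OF this] show ?case
    by (simp only: lsubst.simps Let_def id_image)
qed (auto simp: subst_id[unfolded id_def] intro: lalpha.intros)

lemma lalpha_iff: "lalpha P Q \<longleftrightarrow> lsubst id P = lsubst id Q" for P Q :: "'a::infinite rterm"
  by (metis lalpha_lsubst lalpha_lsubst_id lalpha.sym lalpha.trans)

subsection \<open>Labeled terms up to alpha-conversion\<close>

quotient_type (overloaded) 'a lterm = "'a::infinite rterm" / lalpha
  by (intro equivpI reflpI sympI transpI) (fact lalpha.refl, erule lalpha.sym, erule (1) lalpha.trans)

lift_definition ENil :: "'a::infinite lterm" is LNil .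
lift_definition EIn :: "label \<Rightarrow> 'a \<Rightarrow> 'a \<Rightarrow> 'a::infinite lterm \<Rightarrow> 'a lterm" is LIn by (rule lalpha.LIn)
lift_definition EOut :: "label \<Rightarrow> 'a \<Rightarrow> 'a \<Rightarrow> 'a::infinite lterm \<Rightarrow> 'a lterm" is LOut by (rule lalpha.LOut)
lift_definition EPar :: "'a::infinite lterm \<Rightarrow> 'a lterm \<Rightarrow> 'a lterm" is LPar by (rule lalpha.LPar)
lift_definition ERes :: "'a \<Rightarrow> 'a::infinite lterm \<Rightarrow> 'a lterm" is LRes by (rule lalpha.LRes)
lift_definition ERep :: "label \<Rightarrow> 'a::infinite proc \<Rightarrow> 'a lterm" is LRep .

lift_definition fn_l :: "'a::infinite lterm \<Rightarrow> 'a set" is lfn by (rule lalpha_lfn)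

lift_definition subst_l :: "('a \<Rightarrow> 'a) \<Rightarrow> 'a::infinite lterm \<Rightarrow> 'a lterm" is lsubst
  by (simp add: lalpha_lsubst lalpha.refl)

text \<open>\<open>subst1_l P z y\<close> is \<open>P{z/y}\<close>.\<close>

definition subst1_l :: "'a::infinite lterm \<Rightarrow> 'a \<Rightarrow> 'a \<Rightarrow> 'a lterm" where
  "subst1_l P z y = subst_l (id(y := z)) P"

lemma fn_l_simps [simp]:
  "fn_l ENil = {}"
  "fn_l (EIn v x y P) = {x} \<union> (fn_l P - {y})"
  "fn_l (EOut v x y P) = {x, y} \<union> fn_l P"
  "fn_l (EPar P Q) = fn_l P \<union> fn_l Q"
  "fn_l (ERes x P) = fn_l P - {x}"
  "fn_l (ERep v R) = fn R"
proof -
  show "fn_l (ERep v R) = fn R"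
    by (simp add: fn_l.abs_eq ERep.abs_eq)
qed (transfer; simp)+

lemma lterm_alpha:
  "z \<notin> fn_l P \<Longrightarrow> EIn v x y P = EIn v x z (subst1_l P z y)"
  "z \<notin> fn_l P \<Longrightarrow> ERes y P = ERes z (subst1_l P z y)"
  unfolding subst1_l_def
  by (transfer, rule lalpha.LIn_rename, assumption) (transfer, rule lalpha.LRes_rename, assumption)

lemma lsubst_LIn:
  fixes P :: "'a::infinite rterm"
  assumes "y \<notin> \<sigma> ` (lfn P - {y})"
  shows "lalpha (lsubst \<sigma> (LIn v x y P)) (LIn v (\<sigma> x) y (lsubst (\<sigma>(y := y)) P))"
    and "lalpha (lsubst \<sigma> (LRes y P)) (LRes y (lsubst (\<sigma>(y := y)) P))"
  unfolding lalpha_iff lsubst_lsubst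
  by (simp_all only: lsubst.simps Let_def lsubst_lsubst lfn_lsubst image_scope[OF assms]
      lsubst_upd[OF assms] id_o id_image id_apply[of "\<sigma> x"])

text \<open>The usual defining equations of substitution; by alpha-conversion the bound name can
  always be chosen such that the premise of \<open>subst_l_binder\<close> holds.\<close>

lemma subst_l_simps [simp]:
  "subst_l \<sigma> ENil = ENil"
  "subst_l \<sigma> (EOut v x y P) = EOut v (\<sigma> x) (\<sigma> y) (subst_l \<sigma> P)"
  "subst_l \<sigma> (EPar P Q) = EPar (subst_l \<sigma> P) (subst_l \<sigma> Q)"
  "subst_l \<sigma> (ERep v R) = ERep v (subst \<sigma> R)"
proof -
  show "subst_l \<sigma> (ERep v R) = ERep v (subst \<sigma> R)"
    by (simp add: subst_l.abs_eq ERep.abs_eq)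
qed (transfer; simp add: lalpha.refl)+

lemma subst_l_binder:
  "y \<notin> \<sigma> ` (fn_l P - {y}) \<Longrightarrow> subst_l \<sigma> (EIn v x y P) = EIn v (\<sigma> x) y (subst_l (\<sigma>(y := y)) P)"
  "y \<notin> \<sigma> ` (fn_l P - {y}) \<Longrightarrow> subst_l \<sigma> (ERes y P) = ERes y (subst_l (\<sigma>(y := y)) P)"
proof (transfer, rule lsubst_LIn(1), assumption)
qed (transfer, rule lsubst_LIn(2), assumption)

subsection \<open>The labeling function\<close>

primrec rlabel :: "label \<Rightarrow> 'a::infinite rproc \<Rightarrow> 'a rterm" where
  "rlabel v RNil = LNil"
| "rlabel v (RIn x y P) = LIn v x y (rlabel (fst v, snd v + 1) P)"
| "rlabel v (ROut x y P) = LOut v x y (rlabel (fst v, snd v + 1) P)"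
| "rlabel v (RPar P Q) =
     LPar (rlabel (fst v @ [B0], snd v) P) (rlabel (fst v @ [B1], snd v) Q)"
| "rlabel v (RRes x P) = LRes x (rlabel v P)"
| "rlabel v (RRep P) = LRep v (abs_proc P)"

lemma lfn_rlabel: "lfn (rlabel v P) = rfn P"
  by (induction P arbitrary: v) (auto simp: fn.abs_eq)

lemma rlabel_rsubst: "rlabel v (rsubst \<sigma> P) = lsubst \<sigma> (rlabel v P)"
  by (induction P arbitrary: v \<sigma>) (simp_all add: Let_def lfn_rlabel subst.abs_eq)

lift_definition labeling :: "label \<Rightarrow> 'a::infinite proc \<Rightarrow> 'a lterm" is rlabel
proof -
  fix v and P Q :: "'a rproc"
  assume "ralpha P Q"
  then show "lalpha (rlabel v P) (rlabel v Q)"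
  proof (induction arbitrary: v rule: ralpha.induct)
    case (RRep P Q)
    then have "abs_proc P = abs_proc Q" by (simp add: proc.abs_eq_iff)
    then show ?case by (simp add: lalpha.refl)
  next
    case (trans P Q R)
    show ?case by (rule lalpha.trans[OF trans.IH])
  next
    case (sym P Q)
    show ?case by (rule lalpha.sym[OF sym.IH])
  qed (simp_all add: rlabel_rsubst lfn_rlabel lalpha.refl lalpha.LIn lalpha.LOut lalpha.LPar
      lalpha.LRes lalpha.LIn_rename lalpha.LRes_rename)
qed

lemma labeling_simps [simp]:
  "labeling (s, n) PNil = ENil"
  "labeling (s, n) (PIn x y P) = EIn (s, n) x y (labeling (s, n + 1) P)"
  "labeling (s, n) (POut x y P) = EOut (s, n) x y (labeling (s, n + 1) P)"
  "labeling (s, n) (PPar P Q) = EPar (labeling (s @ [B0], n) P) (labeling (s @ [B1], n) Q)"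
  "labeling (s, n) (PRes x P) = ERes x (labeling (s, n) P)"
  "labeling (s, n) (PRep R) = ERep (s, n) R"
proof -
  show "labeling (s, n) (PRep R) = ERep (s, n) R"
    by (induction R rule: proc.abs_induct) (simp add: labeling.abs_eq PRep.abs_eq ERep.abs_eq)
qed (transfer; simp add: lalpha.refl)+

subsection \<open>Labels occurring in a term\<close>

primrec rtop :: "'a::infinite rterm \<Rightarrow> label set" where
  "rtop LNil = {}"
| "rtop (LIn v x y E) = {v}"
| "rtop (LOut v x y E) = {v}"
| "rtop (LPar E F) = rtop E \<union> rtop F"
| "rtop (LRes x E) = rtop E"
| "rtop (LRep v P) = {v}"

primrec rlab :: "'a::infinite rterm \<Rightarrow> label set" where
  "rlab LNil = {}"
| "rlab (LIn v x y E) = {v} \<union> rlab E"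
| "rlab (LOut v x y E) = {v} \<union> rlab E"
| "rlab (LPar E F) = rlab E \<union> rlab F"
| "rlab (LRes x E) = rlab E"
| "rlab (LRep v P) = {v}"

text \<open>The multiset of all occurrences of labels as subscripts of prefixes and replications.\<close>

primrec rlab_occs :: "'a::infinite rterm \<Rightarrow> label multiset" where
  "rlab_occs LNil = {#}"
| "rlab_occs (LIn v x y E) = {#v#} + rlab_occs E"
| "rlab_occs (LOut v x y E) = {#v#} + rlab_occs E"
| "rlab_occs (LPar E F) = rlab_occs E + rlab_occs F"
| "rlab_occs (LRes x E) = rlab_occs E"
| "rlab_occs (LRep v P) = {#v#}"

lemma lsubst_labels:
  "rtop (lsubst \<sigma> E) = rtop E"
  "rlab (lsubst \<sigma> E) = rlab E"
  "rlab_occs (lsubst \<sigma> E) = rlab_occs E"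
  by (induction E arbitrary: \<sigma>) (simp_all add: Let_def)

lemma lalpha_labels:
  assumes "lalpha E F"
  shows "rtop E = rtop F" "rlab E = rlab F" "rlab_occs E = rlab_occs F"
  using assms by (induction rule: lalpha.induct) (simp_all add: lsubst_labels)

lift_definition top_lab :: "'a::infinite lterm \<Rightarrow> label set" is rtop by (rule lalpha_labels)
lift_definition lab :: "'a::infinite lterm \<Rightarrow> label set" is rlab by (rule lalpha_labels)
lift_definition lab_occs :: "'a::infinite lterm \<Rightarrow> label multiset" is rlab_occs
  by (rule lalpha_labels)

lemma top_lab_simps [simp]:
  "top_lab ENil = {}"
  "top_lab (EIn v x y E) = {v}"
  "top_lab (EOut v x y E) = {v}"
  "top_lab (EPar E F) = top_lab E \<union> top_lab F"
  "top_lab (ERes x E) = top_lab E"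
  "top_lab (ERep v P) = {v}"
  by (transfer; simp)+

lemma lab_simps [simp]:
  "lab ENil = {}"
  "lab (EIn v x y E) = {v} \<union> lab E"
  "lab (EOut v x y E) = {v} \<union> lab E"
  "lab (EPar E F) = lab E \<union> lab F"
  "lab (ERes x E) = lab E"
  "lab (ERep v P) = {v}"
  by (transfer; simp)+

lemma lab_occs_simps [simp]:
  "lab_occs ENil = {#}"
  "lab_occs (EIn v x y E) = {#v#} + lab_occs E"
  "lab_occs (EOut v x y E) = {#v#} + lab_occs E"
  "lab_occs (EPar E F) = lab_occs E + lab_occs F"
  "lab_occs (ERes x E) = lab_occs E"
  "lab_occs (ERep v P) = {#v#}"
  by (transfer; simp)+

lemma set_lab_occs: "set_mset (lab_occs E) = lab E"
proof transfer
  show "set_mset (rlab_occs E) = rlab E" for E :: "'a rterm"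
    by (induction E) auto
qed

subsection \<open>Well-formed terms\<close>

inductive well_formed :: "'a::infinite lterm \<Rightarrow> bool" where
  Nil: "well_formed ENil"
| In: "well_formed (labeling (s, n) (PIn x y P))"
| Out: "well_formed (labeling (s, n) (POut x y P))"
| Par: "well_formed E0 \<Longrightarrow> well_formed E1 \<Longrightarrow> top_lab E0 \<Re> top_lab E1 \<Longrightarrow> well_formed (EPar E0 E1)"
| Res: "well_formed E \<Longrightarrow> well_formed (ERes x E)"
| Rep: "well_formed (ERep (s, n) P)"

subsection \<open>Transitions\<close>

inductive ltrans :: "'a::infinite lterm \<Rightarrow> 'a action \<Rightarrow> 'a lterm \<Rightarrow> bool" where
  Input: "ltrans (EIn v x y E) (InAct x z) (subst1_l E z y)"
| Output: "ltrans (EOut v x y E) (OutAct x y) E"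
| Open: "ltrans E (OutAct x y) E' \<Longrightarrow> x \<noteq> y \<Longrightarrow> ltrans (ERes y E) (BOutAct x y) E'"
| Res: "ltrans E \<mu> E' \<Longrightarrow> y \<notin> act_n \<mu> \<Longrightarrow> ltrans (ERes y E) \<mu> (ERes y E')"
| ParL: "ltrans E \<mu> E' \<Longrightarrow> act_bn \<mu> \<inter> fn_l F = {} \<Longrightarrow> ltrans (EPar E F) \<mu> (EPar E' F)"
| ParR: "ltrans F \<mu> F' \<Longrightarrow> act_bn \<mu> \<inter> fn_l E = {} \<Longrightarrow> ltrans (EPar E F) \<mu> (EPar E F')"
| ComL: "ltrans E (InAct x y) E' \<Longrightarrow> ltrans F (OutAct x y) F' \<Longrightarrow>
    ltrans (EPar E F) Tau (EPar E' F')"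
| ComR: "ltrans E (OutAct x y) E' \<Longrightarrow> ltrans F (InAct x y) F' \<Longrightarrow>
    ltrans (EPar E F) Tau (EPar E' F')"
| CloseL: "ltrans E (InAct x y) E' \<Longrightarrow> ltrans F (BOutAct x y) F' \<Longrightarrow> y \<notin> fn_l E \<Longrightarrow>
    ltrans (EPar E F) Tau (ERes y (EPar E' F'))"
| CloseR: "ltrans E (BOutAct x y) E' \<Longrightarrow> ltrans F (InAct x y) F' \<Longrightarrow> y \<notin> fn_l F \<Longrightarrow>
    ltrans (EPar E F) Tau (ERes y (EPar E' F'))"
| Rep: "ptrans P \<mu> P' \<Longrightarrow>
    ltrans (ERep (s, n) P) \<mu> (EPar (labeling (s @ [B0], n + 1) P') (ERep (s @ [B1], n + 1) P))"

end

theory Submission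
  imports Defs
begin

text \<open>
  The string of a label present after a transition extends the string of some label present
  before it, and its number is at least as large. Call a label expired if every label of the
  term whose string is comparable with its own has a larger
  number. The incomparability of labels in parallel components and the increase of the number
  under prefixes and replications make every consumed label expire, and expired labels stay
  expired, so they cannot come back.
\<close>

text \<open>Unlike \<open>well_formed\<close>, this invariant is defined by recursion on the term and constrains all
  labels instead of the top-level ones; hence it is visibly stable under alpha-conversion and
  needs no inversion of alpha-equivalent binders.\<close>

primrec rnested :: "'a::infinite rterm \<Rightarrow> bool" where
  "rnested LNil = True"
| "rnested (LIn v x y E) = (rnested E \<and> (\<forall>w\<in>rlab E. prefix (fst v) (fst w) \<and> snd v < snd w))"
| "rnested (LOut v x y E) = (rnested E \<and> (\<forall>w\<in>rlab E. prefix (fst v) (fst w) \<and> snd v < snd w))"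
| "rnested (LPar E F) = (rnested E \<and> rnested F \<and> rlab E \<Re> rlab F)"
| "rnested (LRes x E) = rnested E"
| "rnested (LRep v P) = True"

lemma rnested_lsubst: "rnested (lsubst \<sigma> E) = rnested E"
  by (induction E arbitrary: \<sigma>) (simp_all add: Let_def lsubst_labels)

lemma lalpha_rnested: "lalpha E F \<Longrightarrow> rnested E = rnested F"
  by (induction rule: lalpha.induct) (simp_all add: rnested_lsubst lsubst_labels lalpha_labels)

lift_definition nested :: "'a::infinite lterm \<Rightarrow> bool" is rnested by (rule lalpha_rnested)

lemma nested_simps [simp]:
  "nested ENil"
  "nested (EIn v x y E) \<longleftrightarrow> nested E \<and> (\<forall>w\<in>lab E. prefix (fst v) (fst w) \<and> snd v < snd w)"
  "nested (EOut v x y E) \<longleftrightarrow> nested E \<and> (\<forall>w\<in>lab E. prefix (fst v) (fst w) \<and> snd v < snd w)"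
  "nested (EPar E F) \<longleftrightarrow> nested E \<and> nested F \<and> lab E \<Re> lab F"
  "nested (ERes x E) \<longleftrightarrow> nested E"
  "nested (ERep v P)"
  by (transfer; simp)+

lemma lab_subst1_l [simp]: "lab (subst1_l E z y) = lab E"
  unfolding subst1_l_def by transfer (rule lsubst_labels)

lemma nested_subst1_l [simp]: "nested (subst1_l E z y) = nested E"
  unfolding subst1_l_def by transfer (rule rnested_lsubst)

lemma rlab_rlabel:
  "w \<in> rlab (rlabel v P) \<Longrightarrow> prefix (fst v) (fst w) \<and> snd v \<le> snd w"
proof (induction P arbitrary: v)
  case (RPar P Q)
  show ?case
    using RPar.prems RPar.IH(1)[of "(fst v @ [B0], snd v)"] RPar.IH(2)[of "(fst v @ [B1], snd v)"]
    by (auto dest: append_prefixD)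
next
  case (RIn x y P)
  show ?case using RIn.prems RIn.IH[of "(fst v, snd v + 1)"] by auto
next
  case (ROut x y P)
  show ?case using ROut.prems ROut.IH[of "(fst v, snd v + 1)"] by auto
qed simp_all

lemma lab_labeling:
  "w \<in> lab (labeling v P) \<Longrightarrow> prefix (fst v) (fst w) \<and> snd v \<le> snd w"
  by transfer (rule rlab_rlabel)

lemma incomparable_iff:
  "M \<Re> N \<longleftrightarrow>
     (\<forall>v\<in>M. \<forall>w\<in>N. \<not> prefix (fst v) (fst w) \<and> \<not> prefix (fst w) (fst v))"
  by (simp add: incomparable_def split_beta)

text \<open>If two extensions were comparable, the strings they extend would both be prefixes of the
  longer one, hence comparable.\<close>

lemma incomparable_extensions:
  assumes "M \<Re> N"
    and "\<And>v. v \<in> M' \<Longrightarrow> \<exists>u\<in>M. prefix (fst u) (fst v)"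
    and "\<And>w. w \<in> N' \<Longrightarrow> \<exists>u\<in>N. prefix (fst u) (fst w)"
  shows "M' \<Re> N'"
  unfolding incomparable_iff
proof (intro ballI)
  fix v w
  assume "v \<in> M'" "w \<in> N'"
  then obtain u u' where u: "u \<in> M" "prefix (fst u) (fst v)"
    and u': "u' \<in> N" "prefix (fst u') (fst w)"
    using assms(2,3) by blast
  from u u' assms(1) have "\<not> prefix (fst u) (fst u')" "\<not> prefix (fst u') (fst u)"
    by (auto simp: incomparable_iff)
  with u(2) u'(2) show "\<not> prefix (fst v) (fst w) \<and> \<not> prefix (fst w) (fst v)"
    by (meson prefix_order.trans prefix_same_cases)
qed

lemma incomparable_siblings: "{(s @ [B0], n)} \<Re> {(s @ [B1], m)}"
  by (auto simp: incomparable_def)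

lemma rnested_rlabel: "rnested (rlabel v P)"
proof (induction P arbitrary: v)
  case (RPar P Q)
  have "rlab (rlabel (fst v @ [B0], snd v) P) \<Re> rlab (rlabel (fst v @ [B1], snd v) Q)"
    by (rule incomparable_extensions[OF incomparable_siblings]) (auto dest!: rlab_rlabel)
  with RPar show ?case by simp
next
  case (RIn x y P)
  \<comment> \<open>Numbers in the continuation start at \<open>snd v + 1\<close>, which makes the
    inequality strict.\<close>
  then show ?case using rlab_rlabel[of _ "(fst v, snd v + 1)" P] by fastforce
next
  case (ROut x y P)
  then show ?case using rlab_rlabel[of _ "(fst v, snd v + 1)" P] by fastforce
qed simp_all

lemma nested_labeling: "nested (labeling v P)"
  by transfer (rule rnested_rlabel)

text \<open>Lets the incomparability of top-level labels, all that \<open>well_formed\<close>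
  demands, pass to all labels. A well-formed prefixed term is a labeling, so its labels extend that
  of the prefix.\<close>

lemma top_lab_prefix:
  assumes "well_formed E" "w \<in> lab E"
  shows "\<exists>u\<in>top_lab E. prefix (fst u) (fst w)"
  using assms
proof (induction)
  case (Par E F)
  then show ?case by auto
qed (auto dest!: lab_labeling)

lemma well_formed_nested: "well_formed E \<Longrightarrow> nested E"
proof (induction rule: well_formed.induct)
  case (Par E F)
  then have "lab E \<Re> lab F"
    by (intro incomparable_extensions[OF Par.hyps(3)]) (rule top_lab_prefix; assumption)+
  with Par show ?case by simp
qed (simp_all only: nested_labeling nested_simps)

text \<open>A repetition would lie below a prefix with the same label, against the increase of
  numbers, or in both parallel components, against incomparability, since a string is a prefix of
  itself.\<close>

lemma nested_unique: "nested E \<Longrightarrow> count (lab_occs E) v \<le> 1"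
proof transfer
  have set: "set_mset (rlab_occs E) = rlab E" for E :: "'a rterm"
    by (induction E) auto
  show "rnested E \<Longrightarrow> count (rlab_occs E) v \<le> 1" for E :: "'a rterm" and v
  proof (induction E)
    case (LPar E F)
    then have "v \<notin> rlab E \<or> v \<notin> rlab F"
      by (cases v) (auto simp: incomparable_def)
    then have "count (rlab_occs E) v = 0 \<or> count (rlab_occs F) v = 0"
      by (simp add: count_eq_zero_iff set)
    with LPar show ?case by auto
  qed (auto simp: set simp flip: not_in_iff)
qed

text \<open>Only replication creates labels, extending its string and raising its number; every
  other label is its own ancestor.\<close>

lemma ltrans_lab_extends:
  "ltrans E \<mu> E' \<Longrightarrow> w \<in> lab E' \<Longrightarrow> \<exists>u\<in>lab E. prefix (fst u) (fst w) \<and> snd u \<le> snd w"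
proof (induction arbitrary: w rule: ltrans.induct)
  case (Rep P \<mu> P' s n)
  then show ?case by (auto dest!: lab_labeling dest: append_prefixD)
qed (simp; blast)+

text \<open>Letting either side stay unchanged covers the rules Par, Com and Close at once.\<close>

lemma ltrans_incomparable:
  assumes "lab E \<Re> lab F"
    and "E' = E \<or> ltrans E \<mu> E'" "F' = F \<or> ltrans F \<nu> F'"
  shows "lab E' \<Re> lab F'"
  using assms(2,3)
  by (intro incomparable_extensions[OF assms(1)]) (blast dest: ltrans_lab_extends)+

lemma ltrans_nested: "ltrans E \<mu> E' \<Longrightarrow> nested E \<Longrightarrow> nested E'"
proof (induction rule: ltrans.induct)
  case (Rep P \<mu> P' s n)
  have "lab (labeling (s @ [B0], n + 1) P') \<Re> {(s @ [B1], n + 1)}"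
    by (rule incomparable_extensions[OF incomparable_siblings]) (auto dest!: lab_labeling)
  then show ?case by (simp add: nested_labeling)
qed (auto intro: ltrans_incomparable)

text \<open>Comparability goes both ways because the ancestor of a label may have a string shorter
  than \<open>fst v\<close>: a replication with such a string could still produce
  \<open>v\<close>.\<close>

definition expired :: "label \<Rightarrow> label set \<Rightarrow> bool" where
  "expired v M \<longleftrightarrow> (\<forall>w\<in>M. prefix (fst v) (fst w) \<or> prefix (fst w) (fst v) \<longrightarrow> snd v < snd w)"

lemma expired_Un [simp]: "expired v (M \<union> N) \<longleftrightarrow> expired v M \<and> expired v N"
  by (auto simp: expired_def)

lemma expired_notin: "expired v M \<Longrightarrow> v \<notin> M"
  by (auto simp: expired_def)

lemma expired_if_nested: "\<forall>w\<in>M. prefix (fst v) (fst w) \<and> snd v < snd w \<Longrightarrow> expired v M"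
  by (auto simp: expired_def)

text \<open>Holds vacuously: no string on the other side is comparable.\<close>

lemma incomparable_expired:
  assumes "M \<Re> N"
  shows "v \<in> M \<Longrightarrow> expired v N" "v \<in> N \<Longrightarrow> expired v M"
  using assms by (auto simp: expired_def incomparable_iff)

lemma ltrans_expired:
  assumes "ltrans E \<mu> E'" "expired v (lab E)"
  shows "expired v (lab E')"
  unfolding expired_def
proof (intro ballI impI)
  fix w
  assume w: "w \<in> lab E'" "prefix (fst v) (fst w) \<or> prefix (fst w) (fst v)"
  with assms(1) obtain u where u: "u \<in> lab E" "prefix (fst u) (fst w)" "snd u \<le> snd w"
    using ltrans_lab_extends by blast
  \<comment> \<open>Either \<open>fst u\<close> and \<open>fst v\<close> are both prefixes of
    \<open>fst w\<close>, or \<open>fst w\<close> lies between \<open>fst u\<close> and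
    \<open>fst v\<close>.\<close>
  with w(2) have "prefix (fst v) (fst u) \<or> prefix (fst u) (fst v)"
    by (meson prefix_order.trans prefix_same_cases)
  with u(1) assms(2) have "snd v < snd u" by (auto simp: expired_def)
  with u(3) show "snd v < snd w" by simp
qed

text \<open>For Com and Close, where the component not containing \<open>v\<close> moves
  too.\<close>

lemma ltrans_step_expired:
  assumes "lab E \<Re> lab F" "ltrans F \<mu> F'" "v \<in> lab E"
  shows "expired v (lab F')"
  using assms ltrans_expired incomparable_expired(1) by blast

lemma ltrans_step_expired':
  assumes "lab E \<Re> lab F" "ltrans E \<mu> E'" "v \<in> lab F"
  shows "expired v (lab E')"
  using assms ltrans_expired incomparable_expired(2) by blast

lemmas expired_intros = incomparable_expired ltrans_step_expired ltrans_step_expired'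

text \<open>The witness is the label of an acting prefix or replication: what it leaves behind has
  larger numbers, and parallel components are incomparable with it.\<close>

lemma nested_consumed_expired:
  "ltrans E \<mu> E' \<Longrightarrow> nested E \<Longrightarrow> \<exists>v\<in>lab E. expired v (lab E')"
proof (induction rule: ltrans.induct)
  case (Rep P \<mu> P' s n)
  then show ?case by (auto simp: expired_def dest!: lab_labeling)
qed (auto intro: expired_intros expired_if_nested)

text \<open>A label either survives in its component or is consumed there and expires; in the other
  component it is expired by incomparability.\<close>

lemma nested_lost_expired:
  "ltrans E \<mu> E' \<Longrightarrow> nested E \<Longrightarrow> v \<in> lab E \<Longrightarrow> v \<in> lab E' \<or> expired v (lab E')"
proof (induction rule: ltrans.induct)
  case (Rep P \<mu> P' s n)
  then show ?case by (auto simp: expired_def dest!: lab_labeling)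
qed (auto intro: expired_intros expired_if_nested)

theorem theorem4p8:
  fixes E :: "'a::infinite lterm"
  assumes "well_formed E"
  shows "(\<forall>s n. count (lab_occs E) (s, n) \<le> 1) \<and>
    (\<forall>\<mu> E'. ltrans E \<mu> E' \<longrightarrow> (\<exists>s n. (s, n) \<in> lab E \<and> (s, n) \<notin> lab E')) \<and>
    (\<forall>(k::nat) (Es :: nat \<Rightarrow> 'a lterm) (\<mu>s :: nat \<Rightarrow> 'a action).
       k \<ge> 1 \<longrightarrow> Es 0 = E \<longrightarrow> (\<forall>i<k. ltrans (Es i) (\<mu>s i) (Es (i + 1))) \<longrightarrow>
       (\<forall>s n. (s, n) \<in> lab (Es 0) \<inter> lab (Es k) \<longrightarrow> (\<forall>i\<in>{1..k - 1}. (s, n) \<in> lab (Es i))))"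
proof (intro conjI allI impI ballI)
  have nested: "nested E" by (rule well_formed_nested[OF assms])
  show "count (lab_occs E) (s, n) \<le> 1" for s n
    by (rule nested_unique[OF nested])
  show "\<exists>s n. (s, n) \<in> lab E \<and> (s, n) \<notin> lab E'" if "ltrans E \<mu> E'" for \<mu> E'
    using nested_consumed_expired[OF that nested] expired_notin by (metis surj_pair)
  fix k :: nat and Es :: "nat \<Rightarrow> 'a lterm" and \<mu>s :: "nat \<Rightarrow> 'a action" and s n i
  assume start: "Es 0 = E" and steps: "\<forall>i<k. ltrans (Es i) (\<mu>s i) (Es (i + 1))"
    and v: "(s, n) \<in> lab (Es 0) \<inter> lab (Es k)" and "i \<in> {1..k - 1}"
  then have "i \<le> k" by auto
  have move: "ltrans (Es j) (\<mu>s j) (Es (Suc j))" if "j < k" for j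
    using steps that by simp
  have nested_Es: "nested (Es j)" if "j \<le> k" for j
    using that
  proof (induction j)
    case (Suc j)
    then show ?case using ltrans_nested[OF move] by simp
  qed (simp add: start nested)
  \<comment> \<open>A present label stays or expires by \<open>nested_lost_expired\<close>; an
    expired one remains so by \<open>ltrans_expired\<close>.\<close>
  have present: "(s, n) \<in> lab (Es j) \<or> expired (s, n) (lab (Es j))" if "j \<le> k" for j
    using that
  proof (induction j)
    case (Suc j)
    then have "j < k" by simp
    with Suc show ?case
      using nested_lost_expired[OF move[of j] nested_Es[of j]] ltrans_expired[OF move[of j]]
      by auto
  qed (use v in simp)
  \<comment> \<open>Absence at \<open>i\<close> would mean expiry there, lasting until
    \<open>k\<close> and contradicting the presence of the label in \<open>Es k\<close>.\<close>
  have "expired (s, n) (lab (Es k))" if "expired (s, n) (lab (Es i))"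
  proof -
    have "j \<le> k \<Longrightarrow> expired (s, n) (lab (Es j))" if "i \<le> j" for j
      using that
    proof (induction rule: dec_induct)
      case (step j)
      then show ?case
        using ltrans_expired[OF move] by simp
    qed (use \<open>expired (s, n) (lab (Es i))\<close> in simp)
    with \<open>i \<le> k\<close> show ?thesis by blast
  qed
  with v present[OF \<open>i \<le> k\<close>] show "(s, n) \<in> lab (Es i)"
    using expired_notin by blast
qed

end
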